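(* Let $\mathcal{X}$ be a program over the memory access alphabet, and suppose that for each partial string $x \in \mathcal{X}$ a read-from function $\mathsf{rf}_x$ is given, assigning to each acquire $l \in E_x$ on a location $a$ a release $\mathsf{rf}_x(l) \in E_x$ on the same location $a$. Then the following are equivalent: (i) $\mathcal{X}$ is SC-relaxed and, for every $x \in \mathcal{X}$ and every acquire $l \in E_x$, $\mathsf{rf}_x(l) = \bigvee \mathcal{H}_x(l)$; (ii) for every $x \in \mathcal{X}$ the following three axioms hold with respect to release/acquire events: (synchronizes-with) for every acquire $l$, $\mathsf{rf}_x(l) \preceq_x l$; (write-coherence) for every location $a$, any two releases on $a$ are comparable under $\preceq_x$; (from-read) for every acquire $l$ and releases $s, s'$ on the same location, if $\mathsf{rf}_x(l) = s$ and $s \prec_x s'$ then $l \preceq_x s'$.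
   Context: A partial string is a triple $x = (E_x, \alpha_x, \preceq_x)$ with $E_x$ a set of events, $\alpha_x$ a labelling of events by letters of an alphabet, and $\preceq_x$ a partial order on $E_x$; $\mathsf{P}_f$ is the set of finite partial strings. For $y,x$ partial strings, $y \sqsubseteq x$ means there is a bijection $f\colon E_x \to E_y$ preserving labels with $e \preceq_x e' \Rightarrow f(e) \preceq_y f(e')$. A program is a set $\mathcal{X} \subseteq \mathsf{P}_f$ closed downward under $\sqsubseteq$. Memory access alphabet: fix disjoint sets of memory locations and registers. Labels are load labels $(t, r, a)$ with $t \in \{\mathsf{none}, \mathsf{acquire}\}$, $r$ a register, $a$ a location, and store labels $(t, a, b)$ with $t \in \{\mathsf{none}, \mathsf{release}\}$, $a$ a location, $b \in \{0,1\}$. An event labelled $(\mathsf{acquire}, r, a)$ is an acquire on $a$; an event labelled $(\mathsf{release}, a, b)$ is a release on $a$. A program $\mathcal{X}$ is SC-relaxed if for every location $a$ and every $x \in \mathcal{X}$, the release events on $a$ are totally ordered by $\preceq_x$, and for every acquire $l$ and release $s$ on $a$ in $E_x$, $l \preceq_x s$ or $s \preceq_x l$. For an acquire $l$ on $a$ in $E_x$, $\mathcal{H}_x(l) = \{s \in E_x : s \preceq_x l,\ s \text{ a release on } a\}$ and $\bigvee \mathcal{H}_x(l)$ denotes its least upper bound in $(E_x, \preceq_x)$ (with $\bigvee\emptyset$ a formal element $\bot$, never equal to an event). $s \prec_x s'$ means $s \preceq_x s'$ and $s \neq s'$. *)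

theory Defs
  imports "HOL-Library.FuncSet"
begin

section \<open>Partial strings and programs\<close>

text \<open>
  The labelling is a function on the event set only, hence it is required to be extensional
  (equal to \<^term>\<open>undefined\<close> outside the event set). Thus two partial strings are
  equal as HOL values iff they are equal as triples.
\<close>

record ('e, 'l) pstring =
  events :: "'e set"
  label :: "'e \<Rightarrow> 'l"
  order :: "'e rel"

definition partial_string :: "('e, 'l) pstring \<Rightarrow> bool" where
  "partial_string x \<longleftrightarrow>
     label x \<in> extensional (events x) \<and> partial_order_on (events x) (order x)"

definition finite_pstrings :: "('e, 'l) pstring set" where
  "finite_pstrings = {x. partial_string x \<and> finite (events x)}"

abbreviation preceq :: "'e \<Rightarrow> ('e, 'l) pstring \<Rightarrow> 'e \<Rightarrow> bool"
    ("(_ \<preceq>\<^bsub>_\<^esub> _)" [51, 0, 51] 50) where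
  "e \<preceq>\<^bsub>x\<^esub> e' \<equiv> (e, e') \<in> order x"

abbreviation prec :: "'e \<Rightarrow> ('e, 'l) pstring \<Rightarrow> 'e \<Rightarrow> bool"
    ("(_ \<prec>\<^bsub>_\<^esub> _)" [51, 0, 51] 50) where
  "e \<prec>\<^bsub>x\<^esub> e' \<equiv> e \<preceq>\<^bsub>x\<^esub> e' \<and> e \<noteq> e'"

definition refines :: "('e, 'l) pstring \<Rightarrow> ('e, 'l) pstring \<Rightarrow> bool" (infix "\<sqsubseteq>" 50) where
  "y \<sqsubseteq> x \<longleftrightarrow>
     (\<exists>f. bij_betw f (events x) (events y) \<and>
          (\<forall>e\<in>events x. label y (f e) = label x e) \<and>
          (\<forall>e\<in>events x. \<forall>e'\<in>events x. e \<preceq>\<^bsub>x\<^esub> e' \<longrightarrow> f e \<preceq>\<^bsub>y\<^esub> f e'))"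

definition program :: "('e, 'l) pstring set \<Rightarrow> bool" where
  "program X \<longleftrightarrow>
     X \<subseteq> finite_pstrings \<and> (\<forall>x\<in>X. \<forall>y\<in>finite_pstrings. y \<sqsubseteq> x \<longrightarrow> y \<in> X)"

section \<open>Memory access alphabet\<close>

text \<open>
  Registers and locations are disjoint because they are given by separate types.
  The stored bit is a \<^typ>\<open>bool\<close>, with \<^term>\<open>False\<close> for 0 and
  \<^term>\<open>True\<close> for 1.
\<close>

datatype load_mode = Load_None | Acquire
datatype store_mode = Store_None | Release

datatype ('reg, 'loc) mem_label =
    Load load_mode 'reg 'loc
  | Store store_mode 'loc bool

type_synonym ('e, 'reg, 'loc) mem_pstring = "('e, ('reg, 'loc) mem_label) pstring"

definition acquires :: "('e, 'reg, 'loc) mem_pstring \<Rightarrow> 'loc \<Rightarrow> 'e set" where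
  "acquires x a = {l \<in> events x. \<exists>r. label x l = Load Acquire r a}"

definition releases :: "('e, 'reg, 'loc) mem_pstring \<Rightarrow> 'loc \<Rightarrow> 'e set" where
  "releases x a = {s \<in> events x. \<exists>b. label x s = Store Release a b}"

section \<open>SC-relaxed programs\<close>

definition SC_relaxed :: "('e, 'reg, 'loc) mem_pstring set \<Rightarrow> bool" where
  "SC_relaxed X \<longleftrightarrow>
     (\<forall>a. \<forall>x\<in>X.
        total_on (releases x a) (order x) \<and>
        (\<forall>l\<in>acquires x a. \<forall>s\<in>releases x a. l \<preceq>\<^bsub>x\<^esub> s \<or> s \<preceq>\<^bsub>x\<^esub> l))"

definition releases_before :: "('e, 'reg, 'loc) mem_pstring \<Rightarrow> 'loc \<Rightarrow> 'e \<Rightarrow> 'e set" where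
  "releases_before x a l = {s \<in> releases x a. s \<preceq>\<^bsub>x\<^esub> l}"

definition is_lub :: "('e, 'l) pstring \<Rightarrow> 'e set \<Rightarrow> 'e \<Rightarrow> bool" where
  "is_lub x S u \<longleftrightarrow>
     u \<in> events x \<and> (\<forall>s\<in>S. s \<preceq>\<^bsub>x\<^esub> u) \<and>
     (\<forall>v\<in>events x. (\<forall>s\<in>S. s \<preceq>\<^bsub>x\<^esub> v) \<longrightarrow> u \<preceq>\<^bsub>x\<^esub> v)"

text \<open>
  \<^term>\<open>None\<close> is the formal element that is the join of the empty set, even if the order
  happens to have a least event. It also stands for a join that does not exist.
\<close>

definition Join :: "('e, 'l) pstring \<Rightarrow> 'e set \<Rightarrow> 'e option" where
  "Join x S =
     (if S \<noteq> {} \<and> (\<exists>u. is_lub x S u) then Some (THE u. is_lub x S u) else None)"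

section \<open>Read-from functions and the axioms\<close>

definition read_from :: "('e, 'reg, 'loc) mem_pstring \<Rightarrow> ('e \<Rightarrow> 'e) \<Rightarrow> bool" where
  "read_from x f \<longleftrightarrow> (\<forall>a. \<forall>l\<in>acquires x a. f l \<in> releases x a)"

definition synchronizes_with :: "('e, 'reg, 'loc) mem_pstring \<Rightarrow> ('e \<Rightarrow> 'e) \<Rightarrow> bool" where
  "synchronizes_with x f \<longleftrightarrow> (\<forall>a. \<forall>l\<in>acquires x a. f l \<preceq>\<^bsub>x\<^esub> l)"

definition write_coherence :: "('e, 'reg, 'loc) mem_pstring \<Rightarrow> bool" where
  "write_coherence x \<longleftrightarrow>
     (\<forall>a. \<forall>s\<in>releases x a. \<forall>s'\<in>releases x a. s \<preceq>\<^bsub>x\<^esub> s' \<or> s' \<preceq>\<^bsub>x\<^esub> s)"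

definition from_read :: "('e, 'reg, 'loc) mem_pstring \<Rightarrow> ('e \<Rightarrow> 'e) \<Rightarrow> bool" where
  "from_read x f \<longleftrightarrow>
     (\<forall>a. \<forall>l\<in>acquires x a. \<forall>s\<in>releases x a. \<forall>s'\<in>releases x a.
        f l = s \<and> s \<prec>\<^bsub>x\<^esub> s' \<longrightarrow> l \<preceq>\<^bsub>x\<^esub> s')"

end

theory Submission
  imports Defs
begin

text \<open>
  Everything happens inside a single partial string. Under the three axioms, comparing any release
  \<open>s\<close> with \<open>rf l\<close> gives either \<open>s \<preceq> rf l \<preceq> l\<close> or, by from-read, \<open>l \<preceq> s\<close>; hence
  acquires and releases are comparable, and \<open>rf l\<close> is even the greatest element of \<open>\<H>(l)\<close>.
  Conversely, \<open>l\<close> is an upper bound of \<open>\<H>(l)\<close>, so the join \<open>rf l\<close> lies below \<open>l\<close>, and a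
  release strictly above \<open>rf l\<close> cannot be in \<open>\<H>(l)\<close>, so it must lie above \<open>l\<close>.
\<close>

lemma partial_stringD:
  assumes "partial_string x"
  shows partial_string_refl: "e \<in> events x \<Longrightarrow> e \<preceq>\<^bsub>x\<^esub> e"
    and partial_string_trans: "e \<preceq>\<^bsub>x\<^esub> e' \<Longrightarrow> e' \<preceq>\<^bsub>x\<^esub> e'' \<Longrightarrow> e \<preceq>\<^bsub>x\<^esub> e''"
    and partial_string_antisym: "e \<preceq>\<^bsub>x\<^esub> e' \<Longrightarrow> e' \<preceq>\<^bsub>x\<^esub> e \<Longrightarrow> e = e'"
  using assms
  by (auto simp: partial_string_def partial_order_on_def preorder_on_def refl_on_def
      dest: transD antisymD)

lemma is_lub_unique:
  assumes "partial_string x" "is_lub x S u" "is_lub x S v"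
  shows "u = v"
  using assms by (auto simp: is_lub_def intro: partial_string_antisym)

text \<open>Least upper bounds are unique by antisymmetry, so \<open>THE\<close> returns whichever
  one is given. Nonemptiness remains as a condition because the join of the empty set is
  \<open>None\<close> even if a least event exists.\<close>

lemma Join_eq_Some_iff:
  assumes "partial_string x"
  shows "Join x S = Some u \<longleftrightarrow> S \<noteq> {} \<and> is_lub x S u"
proof -
  have "(THE v. is_lub x S v) = u" if "is_lub x S u" for u
    using that is_lub_unique[OF assms] by blast
  then show ?thesis
    by (auto simp: Join_def)
qed

lemma acquires_releases_disjoint: "l \<in> acquires x a \<Longrightarrow> s \<in> releases x b \<Longrightarrow> l \<noteq> s"
  by (auto simp: acquires_def releases_def)

text \<open>\<open>total_on\<close> only compares distinct elements; reflexivity on events supplies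
  the diagonal that \<open>write_coherence\<close> includes. Moving the quantifier over
  \<open>x\<close> outward allows arguing in one partial string at a time.\<close>

lemma SC_relaxed_iff:
  assumes "\<And>x. x \<in> X \<Longrightarrow> partial_string x"
  shows "SC_relaxed X \<longleftrightarrow>
    (\<forall>x\<in>X. write_coherence x \<and>
       (\<forall>a. \<forall>l\<in>acquires x a. \<forall>s\<in>releases x a. l \<preceq>\<^bsub>x\<^esub> s \<or> s \<preceq>\<^bsub>x\<^esub> l))"
proof -
  have "(\<forall>a. total_on (releases x a) (order x)) \<longleftrightarrow> write_coherence x" if "x \<in> X" for x
  proof -
    have "s \<preceq>\<^bsub>x\<^esub> s" if "s \<in> releases x a" for s a
      using that partial_string_refl[OF assms[OF \<open>x \<in> X\<close>]] by (simp add: releases_def)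
    then show ?thesis
      unfolding total_on_def write_coherence_def by metis
  qed
  then show ?thesis
    unfolding SC_relaxed_def by blast
qed

text \<open>Write coherence is not among the conclusions: \<open>SC_relaxed_iff\<close> already
  extracts it from SC-relaxedness.\<close>

lemma axioms_if_join:
  assumes "partial_string x"
    and comparable: "\<And>a l s. l \<in> acquires x a \<Longrightarrow> s \<in> releases x a \<Longrightarrow> l \<preceq>\<^bsub>x\<^esub> s \<or> s \<preceq>\<^bsub>x\<^esub> l"
    and join: "\<And>a l. l \<in> acquires x a \<Longrightarrow> Join x (releases_before x a l) = Some (f l)"
  shows "synchronizes_with x f" and "from_read x f"
proof -
  have lub: "is_lub x (releases_before x a l) (f l)" if "l \<in> acquires x a" for a l
    using join[OF that] assms(1) by (simp add: Join_eq_Some_iff)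
  show "synchronizes_with x f"
    using lub by (auto simp: synchronizes_with_def is_lub_def releases_before_def acquires_def)
  show "from_read x f"
    unfolding from_read_def
  proof (intro allI ballI impI, elim conjE)
    fix a l s s'
    assume l: "l \<in> acquires x a" and s': "s' \<in> releases x a"
      and "f l = s" "s \<preceq>\<^bsub>x\<^esub> s'" "s \<noteq> s'"
    \<comment> \<open>Otherwise antisymmetry would give \<open>s = s'\<close>. As \<open>f l\<close>
      bounds \<open>releases_before x a l\<close> from above, \<open>s'\<close> is then not in that
      set.\<close>
    then have "\<not> s' \<preceq>\<^bsub>x\<^esub> f l"
      using assms(1) partial_string_antisym by metis
    then have "s' \<notin> releases_before x a l"
      using lub[OF l] by (auto simp: is_lub_def)
    then show "l \<preceq>\<^bsub>x\<^esub> s'"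
      using comparable[OF l s'] s' by (simp add: releases_before_def)
  qed
qed

lemma join_if_axioms:
  assumes "partial_string x" and "read_from x f"
    and "synchronizes_with x f" and "write_coherence x" and "from_read x f"
    and l: "l \<in> acquires x a"
  shows "s \<in> releases x a \<Longrightarrow> l \<preceq>\<^bsub>x\<^esub> s \<or> s \<preceq>\<^bsub>x\<^esub> l"
    and "Join x (releases_before x a l) = Some (f l)"
proof -
  have fl: "f l \<in> releases x a" "f l \<preceq>\<^bsub>x\<^esub> l"
    using assms by (auto simp: read_from_def synchronizes_with_def)
  \<comment> \<open>Write coherence compares \<open>s\<close> with \<open>f l\<close>. From-read
    needs \<open>f l\<close> strictly below \<open>s\<close>; if they coincide, the left disjunct
    holds.\<close>
  have dichotomy: "s \<preceq>\<^bsub>x\<^esub> f l \<or> l \<preceq>\<^bsub>x\<^esub> s" if "s \<in> releases x a" for s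
    using that fl(1) assms(4,5) l partial_string_refl[OF assms(1)]
    unfolding write_coherence_def from_read_def by blast
  then show "l \<preceq>\<^bsub>x\<^esub> s \<or> s \<preceq>\<^bsub>x\<^esub> l" if "s \<in> releases x a"
    using that fl(2) partial_string_trans[OF assms(1)] by blast
  \<comment> \<open>The other alternative, \<open>l\<close> below \<open>s\<close>, would give
    \<open>l = s\<close> by antisymmetry, but no event is both a load and a store.\<close>
  have "s \<preceq>\<^bsub>x\<^esub> f l" if "s \<in> releases_before x a l" for s
    using that dichotomy[of s] l acquires_releases_disjoint[of l x a s a]
      partial_string_antisym[OF assms(1)]
    by (auto simp: releases_before_def)
  \<comment> \<open>Membership does two jobs: the set is nonempty, so the join is not
    \<open>None\<close>, and every upper bound lies above \<open>f l\<close>.\<close>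
  moreover have "f l \<in> releases_before x a l"
    using fl by (simp add: releases_before_def)
  ultimately show "Join x (releases_before x a l) = Some (f l)"
    using assms(1) fl(1) by (auto simp: Join_eq_Some_iff is_lub_def releases_def)
qed

theorem theorem3:
  fixes X :: "('e, 'reg, 'loc) mem_pstring set"
    and rf :: "('e, 'reg, 'loc) mem_pstring \<Rightarrow> 'e \<Rightarrow> 'e"
  assumes "program X"
    and "\<And>x. x \<in> X \<Longrightarrow> read_from x (rf x)"
  shows "(SC_relaxed X \<and>
          (\<forall>x\<in>X. \<forall>a. \<forall>l\<in>acquires x a. Some (rf x l) = Join x (releases_before x a l)))
     \<longleftrightarrow>
         (\<forall>x\<in>X. synchronizes_with x (rf x) \<and> write_coherence x \<and> from_read x (rf x))"
    (is "?sc \<and> ?join \<longleftrightarrow> ?axioms")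
proof -
  have ps: "partial_string x" if "x \<in> X" for x
    using assms(1) that by (auto simp: program_def finite_pstrings_def)
  show ?thesis
  proof (intro iffI conjI)
    assume L: "?sc \<and> ?join"
    show ?axioms
    proof (intro ballI conjI)
      fix x assume x: "x \<in> X"
      have sc: "write_coherence x"
        "\<And>a l s. l \<in> acquires x a \<Longrightarrow> s \<in> releases x a \<Longrightarrow> l \<preceq>\<^bsub>x\<^esub> s \<or> s \<preceq>\<^bsub>x\<^esub> l"
        using L SC_relaxed_iff[OF ps] x by blast+
      have join: "\<And>a l. l \<in> acquires x a \<Longrightarrow> Join x (releases_before x a l) = Some (rf x l)"
        using L x by simp
      show "synchronizes_with x (rf x)"
        by (rule axioms_if_join(1)[OF ps[OF x] sc(2) join])
      show "from_read x (rf x)"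
        by (rule axioms_if_join(2)[OF ps[OF x] sc(2) join])
      show "write_coherence x"
        by (fact sc(1))
    qed
  next
    assume R: ?axioms
    note J = join_if_axioms[OF ps assms(2)]
    show ?sc
      by (subst SC_relaxed_iff) (use ps R J(1) in blast)+
    show ?join
      using R J(2) by simp
  qed
qed

end
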